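(* Let $a\geq 2$ be an integer. Then the graph $Z_0(a-1,a+1;a-2,a+2)$ is transmission irregular if and only if $a$ is odd and $a\not\equiv 1 \pmod 3$.
   Context: For a vertex $x$ of a finite simple connected graph $G$, $\mathrm{Tr}_G(x)=\sum_{u\in V(G)\setminus\{x\}}d_G(x,u)$ is its transmission, where $d_G$ is the shortest-path distance. $G$ is transmission irregular if any two distinct vertices have different transmissions. Let $Z_0$ be the graph obtained from the complete graph $K_4$ by removing one of its edges; it has two (adjacent) vertices of degree $3$ and two (nonadjacent) vertices of degree $2$. For an integer $a\geq 2$, $Z_0(a-1,a+1;a-2,a+2)$ is the graph obtained from $Z_0$ by attaching a pendant path of length $a-1$ to one vertex of degree $3$, a pendant path of length $a+1$ to the other vertex of degree $3$, a pendant path of length $a-2$ to one vertex of degree $2$, and a pendant path of length $a+2$ to the other vertex of degree $2$. Here attaching a pendant path of length $\ell$ at a vertex $v$ means adding $\ell$ new vertices $p_1,\ldots,p_\ell$ and the edges $vp_1,p_1p_2,\ldots,p_{\ell-1}p_\ell$ (nothing is added if $\ell=0$). *)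

theory Defs
  imports "Graph_Theory.Graph_Theory" "HOL-Number_Theory.Cong"
begin

text \<open>
  A simple graph is a \<^locale>\<open>graph\<close> of the library, i.e. a finite loop-free
  symmetric digraph without parallel arcs; an edge corresponds to its two orientations.
  The shortest-path distance is the shortest-path cost
  \<^const>\<open>wf_digraph.\<mu>\<close> for unit arc weights; its values are extended reals.
\<close>

definition graph_dist :: "('a, 'b) pre_digraph \<Rightarrow> 'a \<Rightarrow> 'a \<Rightarrow> ereal" where
  "graph_dist G x y = wf_digraph.\<mu> G (\<lambda>_. 1) x y"

definition transmission :: "('a, 'b) pre_digraph \<Rightarrow> 'a \<Rightarrow> ereal" where
  "transmission G x = (\<Sum>u\<in>verts G - {x}. graph_dist G x u)"

text \<open>The next notion is meant for finite simple connected graphs only.\<close>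

definition transmission_irregular :: "('a, 'b) pre_digraph \<Rightarrow> bool" where
  "transmission_irregular G \<longleftrightarrow>
     (\<forall>x\<in>verts G. \<forall>y\<in>verts G. x \<noteq> y \<longrightarrow> transmission G x \<noteq> transmission G y)"

text \<open>
  Attaching to every vertex \<open>v\<close> of \<open>G\<close> a pendant path of length \<open>l v\<close>:
  \<open>(v, 0)\<close> is the original vertex \<open>v\<close>, and \<open>(v, j)\<close> with \<open>1 \<le> j \<le> l v\<close> is the
  \<open>j\<close>-th new vertex on the path at \<open>v\<close>.
\<close>

definition attach_paths :: "'a pair_pre_digraph \<Rightarrow> ('a \<Rightarrow> nat) \<Rightarrow> ('a \<times> nat) pair_pre_digraph" where
  "attach_paths G l =
     \<lparr> pverts = {(v, j). v \<in> pverts G \<and> j \<le> l v},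
       parcs = {((u, 0), (v, 0)) | u v. (u, v) \<in> parcs G}
             \<union> {((v, j), (v, Suc j)) | v j. v \<in> pverts G \<and> Suc j \<le> l v}
             \<union> {((v, Suc j), (v, j)) | v j. v \<in> pverts G \<and> Suc j \<le> l v} \<rparr>"

text \<open>\<open>K\<^sub>4\<close> without the edge between 2 and 3; thus 0, 1 have degree 3 and 2, 3 have degree 2.\<close>

definition Z0 :: "nat pair_pre_digraph" where
  "Z0 = \<lparr> pverts = {0..<4},
          parcs = {(u, v). u \<in> {0..<4} \<and> v \<in> {0..<4} \<and> u \<noteq> v \<and> {u, v} \<noteq> {2, 3}} \<rparr>"

text \<open>The graph \<open>Z\<^sub>0(p, q; r, s)\<close>.\<close>

definition Z0_paths :: "nat \<Rightarrow> nat \<Rightarrow> nat \<Rightarrow> nat \<Rightarrow> (nat \<times> nat) pair_pre_digraph" where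
  "Z0_paths p q r s = attach_paths Z0 ((\<lambda>_. 0)(0 := p, 1 := q, 2 := r, 3 := s))"

lemma pair_graph_attach_paths:
  assumes "pair_graph G"
  shows "pair_graph (attach_paths G l)"
proof -
  interpret G: pair_graph G by fact
  have V: "finite (pverts (attach_paths G l))"
  proof -
    have "pverts (attach_paths G l) = Sigma (pverts G) (\<lambda>v. {..l v})"
      by (auto simp: attach_paths_def)
    then show ?thesis by (simp add: G.pair_finite_verts)
  qed
  have sub: "parcs (attach_paths G l) \<subseteq> pverts (attach_paths G l) \<times> pverts (attach_paths G l)"
    by (auto simp: attach_paths_def dest: G.in_arcsD1 G.in_arcsD2)
  have sym_G: "(v, u) \<in> parcs G" if "(u, v) \<in> parcs G" for u v
    using G.pair_sym_arcs that by (auto simp: symmetric_def elim: symE)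
  have fin: "finite (parcs (attach_paths G l))"
    using finite_subset[OF sub] V by blast
  have sy: "symmetric (with_proj (attach_paths G l))"
    unfolding symmetric_def by (rule symI) (auto simp: attach_paths_def dest: sym_G)
  have lf: "fst e \<noteq> snd e" if "e \<in> parcs (attach_paths G l)" for e
    using that by (auto simp: attach_paths_def dest: G.pair_no_loops)
  show ?thesis
    by unfold_locales (use sub V fin sy lf in auto)
qed

lemma pair_graph_Z0: "pair_graph Z0"
proof -
  have fin: "finite (parcs Z0)"
    by (rule finite_subset[of _ "{0..<4} \<times> {0..<4}"]) (auto simp: Z0_def)
  have sy: "symmetric (with_proj Z0)"
    unfolding symmetric_def by (rule symI) (auto simp: Z0_def)
  show ?thesis
    by unfold_locales (use fin sy in \<open>auto simp: Z0_def\<close>)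
qed

lemma graph_Z0_paths: "graph (with_proj (Z0_paths p q r s))"
  unfolding Z0_paths_def
  by (intro pair_graph.pair_graphD_graph pair_graph_attach_paths pair_graph_Z0)

lemma connected_Z0_paths: "connected (with_proj (Z0_paths p q r s))"
proof -
  define l :: "nat \<Rightarrow> nat" where "l = (\<lambda>_. 0)(0 := p, 1 := q, 2 := r, 3 := s)"
  define H where "H = attach_paths Z0 l"
  have H: "Z0_paths p q r s = H" by (simp add: Z0_paths_def H_def l_def)
  interpret H: pair_graph H
    unfolding H_def by (intro pair_graph_attach_paths pair_graph_Z0)
  have refl: "(v, 0) \<rightarrow>\<^sup>*\<^bsub>with_proj H\<^esub> (v, 0)" if "v < 4" for v
    by (rule H.reachable_refl) (use that in \<open>simp add: H_def attach_paths_def Z0_def\<close>)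
  have to0: "(v, j) \<rightarrow>\<^sup>*\<^bsub>with_proj H\<^esub> (v, 0)" if "v < 4" "j \<le> l v" for v j
    using that(2)
  proof (induction j)
    case 0
    then show ?case using \<open>v < 4\<close> by (simp add: refl)
  next
    case (Suc j)
    then have "((v, Suc j), (v, j)) \<in> parcs H"
      using that by (auto simp: H_def attach_paths_def Z0_def)
    then have "(v, Suc j) \<rightarrow>\<^sup>*\<^bsub>with_proj H\<^esub> (v, j)"
      by (intro H.reachable_adjI) simp
    then show ?case using Suc by (meson H.reachable_trans Suc_leD)
  qed
  have base: "(v, 0) \<rightarrow>\<^sup>*\<^bsub>with_proj H\<^esub> (0, 0)" if "v < 4" for v
  proof (cases "v = 0")
    case True
    then show ?thesis using refl by simp
  next
    case False
    then have "((v, 0), (0, 0)) \<in> parcs H"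
      using that by (auto simp: H_def attach_paths_def Z0_def doubleton_eq_iff)
    then show ?thesis by (intro H.reachable_adjI) simp
  qed
  have root: "x \<rightarrow>\<^sup>*\<^bsub>with_proj H\<^esub> (0, 0)" if "x \<in> pverts H" for x
  proof -
    obtain v j where "x = (v, j)" "v < 4" "j \<le> l v"
      using \<open>x \<in> pverts H\<close> by (auto simp: H_def attach_paths_def Z0_def)
    then show ?thesis using to0 base H.reachable_trans by metis
  qed
  have "strongly_connected (with_proj H)"
    unfolding strongly_connected_def
  proof (intro conjI ballI)
    have "(0, 0) \<in> pverts H" by (simp add: H_def attach_paths_def Z0_def)
    then show "verts (with_proj H) \<noteq> {}" by auto
    fix x y assume "x \<in> verts (with_proj H)" "y \<in> verts (with_proj H)"
    then have "x \<rightarrow>\<^sup>*\<^bsub>with_proj H\<^esub> (0, 0)" "y \<rightarrow>\<^sup>*\<^bsub>with_proj H\<^esub> (0, 0)"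
      using root by simp_all
    then show "x \<rightarrow>\<^sup>*\<^bsub>with_proj H\<^esub> y"
      using symmetric_reachable[OF H.pair_sym_arcs] H.reachable_trans by blast
  qed
  moreover have "mk_symmetric (with_proj H) = H"
  proof -
    have "(v, u) \<in> parcs H" if "(u, v) \<in> parcs H" for u v
      using H.pair_sym_arcs that by (auto simp: symmetric_def elim: symE)
    then have "(\<Union>e\<in>parcs H. {(fst e, snd e), (snd e, fst e)}) = parcs H"
      by force
    then show ?thesis by (simp add: mk_symmetric_def)
  qed
  ultimately show ?thesis by (simp add: H connected_def)
qed

end

theory Submission
  imports Defs
begin

text \<open>
  The distances in the graph can be written down explicitly. If the pendant paths at the vertices
  \<open>w\<close> of a connected graph have lengths \<open>l w\<close>, then two vertices on the same path have distance
  \<open>\<bar>i - j\<bar>\<close>, and the vertices at heights \<open>j\<close> and \<open>i\<close> on the paths at \<open>v \<noteq> w\<close> have distance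
  \<open>i + j + d v w\<close>. Summing up, the transmission at height \<open>j\<close> on the path at \<open>v\<close> is
  \<open>C + D_v + j\<^sup>2 + (N - 1 - 2 l_v) j\<close>,
  where \<open>N\<close> is the number of vertices, \<open>C\<close> does not depend on the vertex, and \<open>D_v\<close> is the sum
  of the core distances from \<open>v\<close>, each counted once for every vertex of the path.
  This is lemma \<open>transmission_attach_paths\<close>.

  For \<open>Z\<^sub>0(a-1,a+1;a-2,a+2)\<close> one has \<open>N = 4 a + 4\<close>, so the transmissions become four quadratic
  polynomials in \<open>j\<close>, one for each core vertex, and each of them is strictly increasing. Two vertices
  on different paths have the same transmission iff, after completing the squares, two
  numbers \<open>x > y > 0\<close> satisfy \<open>x\<^sup>2 - y\<^sup>2 = 4 K\<close>, with \<open>K\<close> linear in \<open>a\<close>. Then \<open>x = y + 2 m\<close> and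
  \<open>m (y + m) = K\<close>. As \<open>y\<close> is at least about \<open>2 a\<close>, this leaves only \<open>m \<le> 3\<close>
  (\<open>square_difference_factor\<close>), and each \<open>m\<close> determines \<open>y\<close> as a function of \<open>a\<close>. Since
  \<open>y\<close> is odd and bounded by the length of its path, for odd \<open>a\<close> the only solution left is
  \<open>m = 3\<close>, \<open>y = (8 a - 5) / 3\<close> for the paths at the two vertices of degree 2, which requires
  \<open>a \<equiv> 1 (mod 3)\<close>.

  Conversely, for \<open>a = 2 b\<close> the vertices at height \<open>b - 1\<close> on the two paths at the vertices of
  degree 3 and 2 with lengths \<open>a + 1\<close> and \<open>a + 2\<close> have equal transmissions (this is \<open>m = 1\<close>), and
  for \<open>a = 3 b + 1\<close> so do the vertices at heights \<open>b - 1\<close> and \<open>b\<close> on the paths of lengths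
  \<open>a - 2\<close> and \<open>a + 2\<close> (this is \<open>m = 3\<close>).
\<close>

section \<open>Distances from level functions\<close>

text \<open>
  The local conditions that characterise the distance from \<open>x\<close>: no arc rises by more than one level,
  and every vertex other than \<open>x\<close> is entered by an arc from the level just below. They can be checked
  arc by arc, so that no walk has to be written down to determine a distance.
\<close>

definition level_function :: "('a, 'b) pre_digraph \<Rightarrow> 'a \<Rightarrow> ('a \<Rightarrow> nat) \<Rightarrow> bool" where
  "level_function G x f \<longleftrightarrow> f x = 0
     \<and> (\<forall>e\<in>arcs G. f (head G e) \<le> Suc (f (tail G e)))
     \<and> (\<forall>y\<in>verts G. y \<noteq> x \<longrightarrow> (\<exists>e\<in>arcs G. head G e = y \<and> f y = Suc (f (tail G e))))"

lemma (in wf_digraph) level_function_le_awalk_length: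
  assumes "level_function G x f" "awalk u p v"
  shows "f v \<le> f u + length p"
  using assms(2)
proof (induction p arbitrary: u)
  case Nil
  then show ?case by (simp add: awalk_Nil_iff)
next
  case (Cons e p)
  then have e: "e \<in> arcs G" "u = tail G e" and "awalk (head G e) p v"
    by (auto simp: awalk_Cons_iff)
  then have "f v \<le> f (head G e) + length p"
    using Cons.IH by blast
  also have "f (head G e) \<le> Suc (f u)"
    using assms(1) e by (simp add: level_function_def)
  finally show ?case by simp
qed

text \<open>Stepping back to the level below \<open>f y\<close> times must end in \<open>x\<close>, the only vertex of level 0.\<close>

lemma (in wf_digraph) level_function_awalk_exists:
  assumes "level_function G x f" "x \<in> verts G" "y \<in> verts G"
  shows "\<exists>p. awalk x p y \<and> length p = f y"
  using assms(3)
proof (induction "f y" arbitrary: y)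
  case 0
  then have "y = x"
    using assms(1) unfolding level_function_def by force
  with 0 assms(2) show ?case by (auto simp: awalk_Nil_iff)
next
  case (Suc n)
  then have "y \<noteq> x"
    using assms(1) by (auto simp: level_function_def)
  then obtain e where e: "e \<in> arcs G" "head G e = y" "f y = Suc (f (tail G e))"
    using assms(1) Suc.prems unfolding level_function_def by blast
  then obtain p where "awalk x p (tail G e)" "length p = f (tail G e)"
    using Suc.hyps by (metis Suc_inject tail_in_verts)
  then have "awalk x (p @ [e]) y" "length (p @ [e]) = f y"
    using e arc_implies_awalk[of e] by (auto simp del: awalk_append_iff intro: awalk_appendI)
  then show ?case by blast
qed

lemma (in wf_digraph) graph_dist_eq_level:
  assumes "level_function G x f" "x \<in> verts G" "y \<in> verts G"
  shows "graph_dist G x y = ereal (real (f y))"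
proof (rule antisym)
  have cost: "awalk_cost (\<lambda>_. 1) p = real (length p)" for p
    by (induction p) auto
  obtain p where "awalk x p y" "length p = f y"
    using level_function_awalk_exists[OF assms] by blast
  then show "graph_dist G x y \<le> ereal (real (f y))"
    using min_cost_le_walk_cost[of x p y "\<lambda>_. 1"] cost by (simp add: graph_dist_def)
  show "ereal (real (f y)) \<le> graph_dist G x y"
    unfolding graph_dist_def \<mu>_def
  proof (rule INF_greatest)
    fix p assume "p \<in> {p. awalk x p y}"
    then have "f y \<le> f x + length p"
      using level_function_le_awalk_length[OF assms(1)] by simp
    then show "ereal (real (f y)) \<le> ereal (awalk_cost (\<lambda>_. 1) p)"
      using assms(1) by (simp add: cost level_function_def)
  qed
qed

section \<open>Transmissions in a graph with pendant paths\<close>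

text \<open>
  If \<open>f\<close> gives the distances from \<open>v\<close> in the core graph, this gives the distances from \<open>(v, j)\<close>
  after paths have been attached.
\<close>

definition attach_level :: "('a \<Rightarrow> nat) \<Rightarrow> 'a \<Rightarrow> nat \<Rightarrow> 'a \<times> nat \<Rightarrow> nat" where
  "attach_level f v j = (\<lambda>(w, i). if w = v then nat \<bar>int i - int j\<bar> else i + j + f w)"

lemma level_function_attach_paths:
  assumes f: "level_function (with_proj G) v f" and j: "j \<le> l v"
  shows "level_function (with_proj (attach_paths G l)) (v, j) (attach_level f v j)"
  unfolding level_function_def
proof (intro conjI ballI impI)
  have f_arc: "f w \<le> Suc (f u)" if "(u, w) \<in> parcs G" for u w
    using f that by (auto simp: level_function_def)
  have f0: "f v = 0"
    using f by (simp add: level_function_def)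
  show "attach_level f v j (v, j) = 0"
    by (simp add: attach_level_def)
  fix e assume "e \<in> arcs (with_proj (attach_paths G l))"
  then show "attach_level f v j (head (with_proj (attach_paths G l)) e)
      \<le> Suc (attach_level f v j (tail (with_proj (attach_paths G l)) e))"
    by (auto simp: attach_paths_def attach_level_def f0 intro: f_arc f_arc[of v, unfolded f0])
next
  have f0: "f v = 0"
    using f by (simp add: level_function_def)
  let ?H = "with_proj (attach_paths G l)" and ?g = "attach_level f v j"
  fix y assume y: "y \<in> verts ?H" "y \<noteq> (v, j)"
  obtain w i where wi: "y = (w, i)" by (cases y)
  have w: "w \<in> pverts G" "i \<le> l w"
    using y(1) by (auto simp: attach_paths_def wi)
  have "\<exists>x. (x, y) \<in> parcs (attach_paths G l) \<and> ?g y = Suc (?g x)"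
  proof -
    \<comment> \<open>The predecessor of \<open>y\<close>: towards height \<open>j\<close> on the path of \<open>v\<close> itself, towards the
      core on any other path, and inherited from the core if \<open>y\<close> is a core vertex.\<close>
    consider (up) "w = v" "i < j" | (down) k where "i = Suc k" "w = v \<longrightarrow> j \<le> k"
      | (core) "w \<noteq> v" "i = 0"
      using y(2) by (cases i) (force simp: wi)+
    then show ?thesis
    proof cases
      case up
      then show ?thesis using w j
        by (intro exI[of _ "(v, Suc i)"]) (auto simp: attach_paths_def attach_level_def wi)
    next
      case down
      then show ?thesis using w
        by (intro exI[of _ "(w, k)"]) (auto simp: attach_paths_def attach_level_def wi)
    next
      case core
      then obtain u where "(u, w) \<in> parcs G" "f w = Suc (f u)"
        using f w unfolding level_function_def by force
      then show ?thesis using core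
        by (intro exI[of _ "(u, 0)"]) (auto simp: attach_paths_def attach_level_def wi f0)
    qed
  qed
  then show "\<exists>e\<in>arcs ?H. head ?H e = y \<and> ?g y = Suc (?g (tail ?H e))"
    by force
qed

lemma sum_abs_diff_atMost:
  assumes "j \<le> n"
  shows "(\<Sum>i\<le>n. \<bar>int i - int j\<bar>) = (\<Sum>i\<le>n. int i) + int j ^ 2 - int n * int j"
  using assms
proof (induction n)
  case (Suc n)
  show ?case
  proof (cases "j = Suc n")
    case True
    have "(\<Sum>i\<le>n. \<bar>int i - int (Suc n)\<bar>) = (\<Sum>i\<le>n. int (Suc n) - int i)"
      by (intro sum.cong) auto
    also have "\<dots> = (\<Sum>i\<le>n. int i) + int (Suc n)"
      by (induction n) (simp_all add: sum_subtractf algebra_simps)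
    finally show ?thesis
      by (simp add: True power2_eq_square algebra_simps)
  next
    case False
    with Suc show ?thesis by (simp add: algebra_simps)
  qed
qed simp

text \<open>
  The path at \<open>w \<noteq> v\<close> has \<open>l w + 1\<close> vertices, each of which contributes its own height, the core
  distance \<open>f w\<close> and the height \<open>j\<close>. The path at \<open>v\<close> fits the same pattern up to the correction
  \<open>j\<^sup>2 - 2 l j - j\<close>, by the closed form of \<open>\<Sum>\<bar>i - j\<bar>\<close>. Hence only the
  linear coefficient and the core term depend on \<open>v\<close>.
\<close>

lemma transmission_attach_paths:
  assumes G: "pair_graph G"
    and f: "level_function (with_proj G) v f"
    and v: "v \<in> pverts G" "j \<le> l v"
  shows "transmission (with_proj (attach_paths G l)) (v, j) = ereal (real_of_int (
     (\<Sum>w\<in>pverts G. \<Sum>i\<le>l w. int i) + (\<Sum>w\<in>pverts G. int (f w) * (int (l w) + 1))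
     + int j ^ 2 + ((\<Sum>w\<in>pverts G. int (l w) + 1) - 1 - 2 * int (l v)) * int j))"
proof -
  interpret G: pair_graph G by fact
  interpret H: pair_graph "attach_paths G l"
    using G by (rule pair_graph_attach_paths)
  let ?H = "with_proj (attach_paths G l)" and ?g = "attach_level f v j"
  have level: "level_function ?H (v, j) ?g"
    using f v(2) by (rule level_function_attach_paths)
  have V: "verts ?H = Sigma (pverts G) (\<lambda>w. {..l w})"
    by (auto simp: attach_paths_def)
  have vj: "(v, j) \<in> verts ?H" and g0: "?g (v, j) = 0" and f0: "f v = 0"
    using v f by (auto simp: attach_paths_def attach_level_def level_function_def)
  have "transmission ?H (v, j) = (\<Sum>u\<in>verts ?H - {(v, j)}. ereal (real (?g u)))"
    unfolding transmission_def
    by (intro sum.cong refl H.graph_dist_eq_level level vj) (use vj in auto)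
  also have "\<dots> = ereal (real (\<Sum>u\<in>verts ?H - {(v, j)}. ?g u))"
    by simp
  \<comment> \<open>The vertex itself has level 0 and may be added to the sum, which then splits into paths.\<close>
  also have "(\<Sum>u\<in>verts ?H - {(v, j)}. ?g u) = (\<Sum>u\<in>verts ?H. ?g u)"
    by (rule sum.mono_neutral_left) (use g0 in \<open>auto simp: H.pair_finite_verts\<close>)
  also have "real \<dots> = real_of_int (int (\<Sum>u\<in>verts ?H. ?g u))"
    by simp
  also have "int (\<Sum>u\<in>verts ?H. ?g u) = (\<Sum>w\<in>pverts G. \<Sum>i\<le>l w. int (?g (w, i)))"
    unfolding V by (simp add: sum.Sigma)
  also have "\<dots> = (\<Sum>w\<in>pverts G. (\<Sum>i\<le>l w. int i) + int (f w) * (int (l w) + 1)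
      + int j * (int (l w) + 1)
      + (if w = v then int j ^ 2 - 2 * int (l v) * int j - int j else 0))"
  proof (intro sum.cong refl)
    fix w
    show "(\<Sum>i\<le>l w. int (?g (w, i))) = (\<Sum>i\<le>l w. int i) + int (f w) * (int (l w) + 1)
      + int j * (int (l w) + 1)
      + (if w = v then int j ^ 2 - 2 * int (l v) * int j - int j else 0)"
      using sum_abs_diff_atMost[OF v(2)] f0
      by (auto simp: attach_level_def sum.distrib algebra_simps)
  qed
  also have "\<dots> = (\<Sum>w\<in>pverts G. \<Sum>i\<le>l w. int i) + (\<Sum>w\<in>pverts G. int (f w) * (int (l w) + 1))
     + int j ^ 2 + ((\<Sum>w\<in>pverts G. int (l w) + 1) - 1 - 2 * int (l v)) * int j"
    using v(1)
    by (simp add: sum.distrib sum_distrib_left[symmetric] algebra_simps)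
  finally show ?thesis .
qed

section \<open>The transmissions as four quadratic polynomials\<close>

definition Z0_dist :: "nat \<Rightarrow> nat \<Rightarrow> nat" where
  "Z0_dist u v = (if u = v then 0 else if {u, v} = {2, 3} then 2 else 1)"

lemma Z0_verts: "pverts Z0 = {0, 1, 2, 3}"
  by (auto simp: Z0_def)

lemma level_function_Z0:
  assumes "u \<in> pverts Z0"
  shows "level_function (with_proj Z0) u (Z0_dist u)"
  unfolding level_function_def
proof (intro conjI ballI impI)
  show "Z0_dist u u = 0" by (simp add: Z0_dist_def)
next
  fix e assume "e \<in> arcs (with_proj Z0)"
  then show "Z0_dist u (head (with_proj Z0) e) \<le> Suc (Z0_dist u (tail (with_proj Z0) e))"
    by (auto simp: Z0_def Z0_dist_def doubleton_eq_iff split: if_splits)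
next
  fix y assume y: "y \<in> verts (with_proj Z0)" "y \<noteq> u"
  \<comment> \<open>Between the nonadjacent vertices 2 and 3 a shortest path runs through 0.\<close>
  have "(if {u, y} = {2, 3} then 0 else u, y) \<in> parcs Z0"
    using y assms by (auto simp: Z0_def doubleton_eq_iff)
  moreover have "Z0_dist u y = Suc (Z0_dist u (if {u, y} = {2, 3} then 0 else u))"
    using y by (auto simp: Z0_dist_def doubleton_eq_iff)
  ultimately show "\<exists>e\<in>arcs (with_proj Z0). head (with_proj Z0) e = y
      \<and> Z0_dist u y = Suc (Z0_dist u (tail (with_proj Z0) e))"
    by force
qed

text \<open>
  The transmission at height \<open>j\<close> on the path at \<open>v\<close>, up to a summand common to all vertices. The first
  list holds the core terms \<open>D_v\<close>, the second the coefficients \<open>N - 1 - 2 l_v\<close> with \<open>N = 4 a + 4\<close>.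
  The height is an integer so that the squares can be completed without truncated subtraction.
\<close>

definition Z0_excess :: "int \<Rightarrow> nat \<Rightarrow> int \<Rightarrow> int" where
  "Z0_excess a v j = [3*a + 4, 3*a + 2, 4*a + 8, 4*a] ! v
     + j ^ 2 + [2*a + 5, 2*a + 1, 2*a + 7, 2*a - 1] ! v * j"

lemma less_4_cases:
  fixes v :: nat
  assumes "v < 4"
  obtains "v = 0" | "v = 1" | "v = 2" | "v = 3"
  using assms by linarith

lemma transmission_Z0_paths:
  fixes a :: nat
  assumes "a \<ge> 2"
  obtains C :: int where
    "\<And>v j. (v, j) \<in> pverts (Z0_paths (a - 1) (a + 1) (a - 2) (a + 2)) \<Longrightarrow>
      transmission (with_proj (Z0_paths (a - 1) (a + 1) (a - 2) (a + 2))) (v, j)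
        = ereal (real_of_int (C + Z0_excess (int a) v (int j)))"
proof
  define l :: "nat \<Rightarrow> nat"
    where "l = (\<lambda>_. 0)(0 := a - 1, 1 := a + 1, 2 := a - 2, 3 := a + 2)"
  fix v j
  assume "(v, j) \<in> pverts (Z0_paths (a - 1) (a + 1) (a - 2) (a + 2))"
  then have v: "v \<in> pverts Z0" and j: "j \<le> l v"
    by (auto simp: Z0_paths_def attach_paths_def l_def)
  have paths: "Z0_paths (a - 1) (a + 1) (a - 2) (a + 2) = attach_paths Z0 l"
    by (simp add: Z0_paths_def l_def)
  have l: "int (l 0) = int a - 1" "int (l 1) = int a + 1" "int (l 2) = int a - 2"
      "int (l 3) = int a + 2" "int (l (Suc 0)) = int a + 1"
    using assms by (auto simp: l_def)
  have "v < 4" using v by (auto simp: Z0_def)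
  have "(\<Sum>w\<in>pverts Z0. int (Z0_dist v w) * (int (l w) + 1))
      = [3 * int a + 4, 3 * int a + 2, 4 * int a + 8, 4 * int a] ! v"
    using \<open>v < 4\<close>
    by (cases rule: less_4_cases) (simp_all add: Z0_verts l Z0_dist_def doubleton_eq_iff)
  moreover have "(\<Sum>w\<in>pverts Z0. int (l w) + 1) = 4 * int a + 4"
    by (simp add: Z0_verts l)
  moreover have "4 * int a + 4 - 1 - 2 * int (l v)
      = [2 * int a + 5, 2 * int a + 1, 2 * int a + 7, 2 * int a - 1] ! v"
    using \<open>v < 4\<close> by (cases rule: less_4_cases) (simp_all add: l)
  ultimately have excess: "(\<Sum>w\<in>pverts Z0. int (Z0_dist v w) * (int (l w) + 1))
      + int j ^ 2 + ((\<Sum>w\<in>pverts Z0. int (l w) + 1) - 1 - 2 * int (l v)) * int j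
      = Z0_excess (int a) v (int j)"
    unfolding Z0_excess_def by (simp only:)
  show "transmission (with_proj (Z0_paths (a - 1) (a + 1) (a - 2) (a + 2))) (v, j)
      = ereal (real_of_int ((\<Sum>w\<in>pverts Z0. \<Sum>i\<le>l w. int i) + Z0_excess (int a) v (int j)))"
    unfolding paths excess[symmetric]
      transmission_attach_paths[where l = l, OF pair_graph_Z0 level_function_Z0[OF v] v j]
    by (simp only: add.assoc)
qed

section \<open>Coincidences between different paths\<close>

text \<open>
  As \<open>x\<close> and \<open>y\<close> have the same parity, \<open>x = y + 2 m\<close>, and the equation becomes \<open>m (y + m) = K\<close>.
  The left-hand side increases with both \<open>m\<close> and \<open>y\<close>, so a lower bound \<open>L\<close> on \<open>y\<close> bounds \<open>m\<close>.
\<close>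

lemma square_difference_factor:
  fixes x y K L M :: int
  assumes eq: "x\<^sup>2 = y\<^sup>2 + 4 * K" and K: "0 < K" and x: "0 < x"
    and L: "0 \<le> L" "L \<le> y" and M: "0 \<le> M" "K < M * (L + M)"
  obtains m where "1 \<le> m" "m < M" "x = y + 2 * m" "m * (y + m) = K"
proof -
  have "even (x\<^sup>2 - y\<^sup>2)" using eq by simp
  then have "even (x - y)" by simp
  then obtain m where m: "x = y + 2 * m"
    by (metis add.commute diff_add_cancel evenE)
  have K': "m * (y + m) = K"
    using eq by (simp add: m power2_eq_square algebra_simps)
  have "1 \<le> m"
  proof (rule ccontr)
    assume "\<not> 1 \<le> m"
    moreover have "0 < y + m" using x m L by (simp add: m)
    ultimately have "m * (y + m) \<le> 0"
      by (simp add: mult_nonpos_nonneg)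
    with K K' show False by simp
  qed
  moreover have "m < M"
  proof (rule ccontr)
    assume "\<not> m < M"
    then have "M * (L + M) \<le> m * (y + m)"
      using L M by (intro mult_mono) auto
    with M K' show False by simp
  qed
  ultimately show thesis using m K' that by blast
qed

text \<open>
  Completing the squares, which turns equal transmissions into a difference of two odd squares.
\<close>

lemma Z0_excess_square:
  "4 * Z0_excess a 0 j = (2*j + 2*a + 5)\<^sup>2 - 4*a\<^sup>2 - 8*a - 9"
  "4 * Z0_excess a 1 j = (2*j + 2*a + 1)\<^sup>2 - 4*a\<^sup>2 + 8*a + 7"
  "4 * Z0_excess a 2 j = (2*j + 2*a + 7)\<^sup>2 - 4*a\<^sup>2 - 12*a - 17"
  "4 * Z0_excess a 3 j = (2*j + 2*a - 1)\<^sup>2 - 4*a\<^sup>2 + 20*a - 1"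
  by (simp_all add: Z0_excess_def power2_eq_square algebra_simps eval_nat_numeral)

lemma Z0_excess_strict_mono:
  assumes "v < 4" "2 \<le> a" "0 \<le> j" "j < k"
  shows "Z0_excess a v j < Z0_excess a v k"
proof -
  have "j\<^sup>2 \<le> k\<^sup>2" using assms by (intro power_mono) auto
  moreover have "0 < [2*a + 5, 2*a + 1, 2*a + 7, 2*a - 1] ! v"
    using assms(1) by (cases rule: less_4_cases) (use assms(2) in simp_all)
  then have "[2*a + 5, 2*a + 1, 2*a + 7, 2*a - 1] ! v * j
      < [2*a + 5, 2*a + 1, 2*a + 7, 2*a - 1] ! v * k"
    using assms(4) by (rule mult_strict_left_mono[rotated])
  ultimately show ?thesis
    unfolding Z0_excess_def by linarith
qed

text \<open>
  The six pairs of paths. In each case the lower bound \<open>L\<close> is the value of the smaller root at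
  height 0, and \<open>M\<close> is the least bound that this allows for all \<open>a \<ge> 2\<close>.
  Each remaining \<open>m\<close> is excluded by the length of a path or by a congruence, where the oddness of
  the roots is visible in their form \<open>2 j + 2 a + c\<close> with odd \<open>c\<close>.
\<close>

context
  fixes a j k :: int
  assumes a: "2 \<le> a"
    and jk: "0 \<le> j" "0 \<le> k"
begin

lemma Z0_excess_0_neq_1:
  assumes "j \<le> a - 1"
  shows "Z0_excess a 0 j \<noteq> Z0_excess a 1 k"
proof
  assume "Z0_excess a 0 j = Z0_excess a 1 k"
  then have "(2*j + 2*a + 5)\<^sup>2 = (2*k + 2*a + 1)\<^sup>2 + 4 * (4*a + 4)"
    using Z0_excess_square(1)[of a j] Z0_excess_square(2)[of a k] by simp
  then obtain m where m: "1 \<le> m" "m < 2" "2*j + 2*a + 5 = (2*k + 2*a + 1) + 2 * m"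
      "m * (2*k + 2*a + 1 + m) = 4*a + 4"
    by (rule square_difference_factor[where L = "2*a + 1" and M = 2]) (use a jk in auto)
  then have "m = 1" by simp
  with m assms show False by simp
qed

lemma Z0_excess_0_neq_2: "Z0_excess a 0 j \<noteq> Z0_excess a 2 k"
proof
  assume "Z0_excess a 0 j = Z0_excess a 2 k"
  then have "(2*k + 2*a + 7)\<^sup>2 = (2*j + 2*a + 5)\<^sup>2 + 4 * (a + 2)"
    using Z0_excess_square(1)[of a j] Z0_excess_square(3)[of a k] by simp
  then show False
    by (rule square_difference_factor[where L = "2*a + 5" and M = 1]) (use a jk in auto)
qed

lemma Z0_excess_0_neq_3:
  assumes "odd a" "k \<le> a + 2"
  shows "Z0_excess a 0 j \<noteq> Z0_excess a 3 k"
proof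
  assume "Z0_excess a 0 j = Z0_excess a 3 k"
  then have "(2*j + 2*a + 5)\<^sup>2 = (2*k + 2*a - 1)\<^sup>2 + 4 * (7*a + 2)"
    using Z0_excess_square(1)[of a j] Z0_excess_square(4)[of a k] by simp
  then obtain m where m: "1 \<le> m" "m < 4" "2*j + 2*a + 5 = (2*k + 2*a - 1) + 2 * m"
      "m * (2*k + 2*a - 1 + m) = 7*a + 2"
    by (rule square_difference_factor[where L = "2*a - 1" and M = 4]) (use a jk in auto)
  then consider "m = 1" | "m = 2" | "m = 3" by linarith
  then show False
  proof cases
    case 1
    with m(3,4) assms a show False by simp
  next
    case 2
    from m(4) have "2 * (2*k + 2*a - 1 + 2) = 7*a + 2" unfolding 2 .
    with assms(1) show False by presburger
  next
    case 3
    from m(4) have "3 * (2*k + 2*a - 1 + 3) = 7*a + 2" unfolding 3 .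
    with assms(1) show False by presburger
  qed
qed

lemma Z0_excess_1_neq_2:
  assumes "odd a" "j \<le> a + 1"
  shows "Z0_excess a 1 j \<noteq> Z0_excess a 2 k"
proof
  assume "Z0_excess a 1 j = Z0_excess a 2 k"
  then have "(2*k + 2*a + 7)\<^sup>2 = (2*j + 2*a + 1)\<^sup>2 + 4 * (5*a + 6)"
    using Z0_excess_square(2)[of a j] Z0_excess_square(3)[of a k] by simp
  then obtain m where m: "1 \<le> m" "m < 3" "2*k + 2*a + 7 = (2*j + 2*a + 1) + 2 * m"
      "m * (2*j + 2*a + 1 + m) = 5*a + 6"
    by (rule square_difference_factor[where L = "2*a + 1" and M = 3]) (use a jk in auto)
  then consider "m = 1" | "m = 2" by linarith
  then show False
  proof cases
    case 1
    with m(3,4) assms a show False by simp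
  next
    case 2
    from m(4) have "2 * (2*j + 2*a + 1 + 2) = 5*a + 6" unfolding 2 .
    with assms(1) show False by presburger
  qed
qed

lemma Z0_excess_1_neq_3:
  assumes "odd a"
  shows "Z0_excess a 1 j \<noteq> Z0_excess a 3 k"
proof
  assume "Z0_excess a 1 j = Z0_excess a 3 k"
  then have "(2*j + 2*a + 1)\<^sup>2 = (2*k + 2*a - 1)\<^sup>2 + 4 * (3*a - 2)"
    using Z0_excess_square(2)[of a j] Z0_excess_square(4)[of a k] by simp
  then obtain m where m: "1 \<le> m" "m < 2" "2*j + 2*a + 1 = (2*k + 2*a - 1) + 2 * m"
      "m * (2*k + 2*a - 1 + m) = 3*a - 2"
    by (rule square_difference_factor[where L = "2*a - 1" and M = 2]) (use a jk in auto)
  then have "m = 1" by simp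
  with m(4) have "2*k + 2*a - 1 + 1 = 3*a - 2" by simp
  with assms(1) show False by presburger
qed

lemma Z0_excess_2_neq_3:
  assumes "a mod 3 \<noteq> 1" "k \<le> a + 2"
  shows "Z0_excess a 2 j \<noteq> Z0_excess a 3 k"
proof
  assume "Z0_excess a 2 j = Z0_excess a 3 k"
  then have "(2*j + 2*a + 7)\<^sup>2 = (2*k + 2*a - 1)\<^sup>2 + 4 * (8*a + 4)"
    using Z0_excess_square(3)[of a j] Z0_excess_square(4)[of a k] by simp
  then obtain m where m: "1 \<le> m" "m < 4" "2*j + 2*a + 7 = (2*k + 2*a - 1) + 2 * m"
      "m * (2*k + 2*a - 1 + m) = 8*a + 4"
    by (rule square_difference_factor[where L = "2*a - 1" and M = 4]) (use a jk in auto)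
  then consider "m = 1" | "m = 2" | "m = 3" by linarith
  then show False
  proof cases
    case 1
    with m(3,4) assms a show False by simp
  next
    case 2
    from m(4) have "2 * (2*k + 2*a - 1 + 2) = 8*a + 4" unfolding 2 .
    with assms(1) show False by presburger
  next
    case 3
    from m(4) have "3 * (2*k + 2*a - 1 + 3) = 8*a + 4" unfolding 3 .
    with assms(1) show False by presburger
  qed
qed

end

theorem theorem4p1:
  fixes a :: nat
  assumes "a \<ge> 2"
  shows "transmission_irregular (with_proj (Z0_paths (a - 1) (a + 1) (a - 2) (a + 2)))
         \<longleftrightarrow> odd a \<and> \<not> [a = 1] (mod 3)"
proof -
  let ?G = "Z0_paths (a - 1) (a + 1) (a - 2) (a + 2)"
  let ?t = "\<lambda>(v, j). Z0_excess (int a) v (int j)"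
  obtain C where "transmission (with_proj ?G) (v, j)
      = ereal (real_of_int (C + Z0_excess (int a) v (int j)))"
    if "(v, j) \<in> pverts ?G" for v j
    using transmission_Z0_paths[OF assms] by blast
  then have "transmission (with_proj ?G) x = transmission (with_proj ?G) y \<longleftrightarrow> ?t x = ?t y"
    if "x \<in> pverts ?G" "y \<in> pverts ?G" for x y
    using that by (cases x; cases y) (simp del: of_int_add)
  then have irr: "transmission_irregular (with_proj ?G) \<longleftrightarrow> inj_on ?t (pverts ?G)"
    unfolding transmission_irregular_def inj_on_def by (auto simp del: split_paired_All)
  have verts: "(v, j) \<in> pverts ?G \<longleftrightarrow> v < 4 \<and> j \<le> [a - 1, a + 1, a - 2, a + 2] ! v" for v j
    by (auto simp: Z0_paths_def attach_paths_def Z0_def eval_nat_numeral less_Suc_eq)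
  show ?thesis
    unfolding irr
  proof
    assume inj: "inj_on ?t (pverts ?G)"
    have "odd a"
    proof
      assume "even a"
      then obtain b where b: "a = 2 * b" by blast
      \<comment> \<open>The solution \<open>m = 1\<close>, \<open>y = 3 a - 3\<close> for the paths at 1 and 3, translated into heights.\<close>
      have "?t (1, b - 1) = ?t (3, b - 1)"
        using assms by (simp add: Z0_excess_def b of_nat_diff algebra_simps eval_nat_numeral)
      moreover have "(1, b - 1) \<in> pverts ?G" "(3, b - 1) \<in> pverts ?G"
        unfolding verts using assms by (simp_all add: b)
      ultimately have "(1, b - 1) = (3 :: nat, b - 1)"
        using inj unfolding inj_on_def by blast
      then show False by simp
    qed
    moreover have "\<not> [a = 1] (mod 3)"
    proof
      assume "[a = 1] (mod 3)"
      then have "a mod 3 = 1" by (simp add: cong_def)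
      then obtain b where b: "a = 3 * b + 1"
        by (metis mult_div_mod_eq)
      with assms have "1 \<le> b" by simp
      \<comment> \<open>The solution \<open>m = 3\<close>, \<open>y = 8 b + 1\<close> for the paths at 2 and 3, translated into heights.\<close>
      then have "?t (2, b - 1) = ?t (3, b)"
        by (simp add: Z0_excess_def b of_nat_diff power2_eq_square algebra_simps eval_nat_numeral)
      moreover have "(2, b - 1) \<in> pverts ?G" "(3, b) \<in> pverts ?G"
        unfolding verts by (simp_all add: b)
      ultimately have "(2, b - 1) = (3 :: nat, b)"
        using inj unfolding inj_on_def by blast
      then show False by simp
    qed
    ultimately show "odd a \<and> \<not> [a = 1] (mod 3)" by blast
  next
    assume a: "odd a \<and> \<not> [a = 1] (mod 3)"
    have a': "2 \<le> int a" "odd (int a)" "int a mod 3 \<noteq> 1"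
      using a assms by (auto simp: cong_def) presburger
    have same: "j = k" if "v < 4" "Z0_excess (int a) v (int j) = Z0_excess (int a) v (int k)" for v j k
      using Z0_excess_strict_mono[OF that(1) a'(1)] that(2)
      by (metis less_irrefl linorder_neqE_nat of_nat_0_le_iff of_nat_less_iff)
    have cross: "Z0_excess (int a) u (int j) \<noteq> Z0_excess (int a) v (int k)"
      if "u < v" "(u, j) \<in> pverts ?G" "(v, k) \<in> pverts ?G" for u v j k
    proof -
      have b: "u < 4" "v < 4" "j \<le> [a - 1, a + 1, a - 2, a + 2] ! u"
        "k \<le> [a - 1, a + 1, a - 2, a + 2] ! v"
        using that(2,3) unfolding verts by blast+
      consider "u = 0" "v = 1" | "u = 0" "v = 2" | "u = 0" "v = 3"
        | "u = 1" "v = 2" | "u = 1" "v = 3" | "u = 2" "v = 3"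
        using b(1,2) \<open>u < v\<close> by linarith
      then show ?thesis
      proof cases
        case 1
        with b(3) assms have "int j \<le> int a - 1" by simp
        with 1 show ?thesis
          using Z0_excess_0_neq_1[of "int a" "int j" "int k"] a' by simp
      next
        case 2
        then show ?thesis
          using Z0_excess_0_neq_2[of "int a" "int j" "int k"] a' by simp
      next
        case 3
        with b(4) assms have "int k \<le> int a + 2" by simp
        with 3 show ?thesis
          using Z0_excess_0_neq_3[of "int a" "int j" "int k"] a' by simp
      next
        case 4
        with b(3) assms have "int j \<le> int a + 1" by simp
        with 4 show ?thesis
          using Z0_excess_1_neq_2[of "int a" "int j" "int k"] a' by simp
      next
        case 5
        then show ?thesis
          using Z0_excess_1_neq_3[of "int a" "int j" "int k"] a' by simp
      next
        case 6
        with b(4) assms have "int k \<le> int a + 2" by simp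
        with 6 show ?thesis
          using Z0_excess_2_neq_3[of "int a" "int j" "int k"] a' by simp
      qed
    qed
    show "inj_on ?t (pverts ?G)"
    proof (rule inj_onI)
      fix x y assume xy: "x \<in> pverts ?G" "y \<in> pverts ?G" "?t x = ?t y"
      obtain u j v k where uv: "x = (u, j)" "y = (v, k)" by (cases x; cases y)
      have in_G: "(u, j) \<in> pverts ?G" "(v, k) \<in> pverts ?G"
        and eq: "Z0_excess (int a) u (int j) = Z0_excess (int a) v (int k)"
        using xy by (simp_all only: uv split)
      have "u = v"
        using cross[OF _ in_G] cross[OF _ in_G(2,1)] eq by (metis linorder_neqE_nat)
      moreover have "u < 4"
        using in_G(1) unfolding verts by blast
      ultimately show "x = y"
        using same[of u j k] eq by (simp only: uv)
    qed
  qed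
qed

end
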